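(* Let $s>1$ be a natural number and let $f\in\Lambda_s$ be a function that is not a $\Lambda_s$-linear function. Then $f$ is nowhere differentiable on its domain (i.e. $f$ has no derivative at any point of its domain).
   Context: Let $s>1$ be a fixed natural number and $A=\{0,1,\dots,s-1\}$. For digits $\alpha_n\in A$ write $\Delta^{s}_{\alpha_1\alpha_2\dots\alpha_n\dots}=\sum_{n=1}^{\infty}\frac{\alpha_n}{s^n}\in[0,1]$ (s-adic representation) and $\Delta^{-s}_{\alpha_1\alpha_2\dots\alpha_n\dots}=\sum_{n=1}^{\infty}\frac{(-1)^n\alpha_n}{s^n}\in\left[-\frac{s}{s+1},\frac{1}{s+1}\right]$ (nega-s-adic representation). An s-adic rational number is one with two s-adic representations $\Delta^s_{\alpha_1\dots\alpha_{n-1}\alpha_n000\dots}=\Delta^s_{\alpha_1\dots\alpha_{n-1}[\alpha_n-1][s-1][s-1]\dots}$; a nega-s-adic rational number is one with two nega-s-adic representations $\Delta^{-s}_{\alpha_1\dots\alpha_{n-1}\alpha_n[s-1]0[s-1]0\dots}=\Delta^{-s}_{\alpha_1\dots\alpha_{n-1}[\alpha_n-1]0[s-1]0[s-1]\dots}$ ($\alpha_n\neq0$). All other numbers of $[0,1]$ (resp. $[-\frac{s}{s+1},\frac1{s+1}]$) are called s-adic (resp. nega-s-adic) irrational and have a unique representation. The class $\Lambda_s$ consists of the functions $f:\ x=\Delta^{\pm s}_{\alpha_1\alpha_2\dots\alpha_n\dots}\mapsto \Delta^{\pm s}_{\beta_1\beta_2\dots\beta_n\dots}=f(x)$ (the argument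 is represented either s-adically or nega-s-adically, and the value either s-adically or nega-s-adically, these choices being fixed for the given $f$), where $(\beta_{km+1},\dots,\beta_{(m+1)k})=\theta(\alpha_{km+1},\dots,\alpha_{(m+1)k})$ for $m=0,1,2,\dots$, $k$ is a positive integer fixed for the given $f$, and $\theta:A^k\to A^k$ is a bijection. The domain of $f$ is $[0,1]$ if the argument is represented s-adically and $[-\frac{s}{s+1},\frac{1}{s+1}]$ if it is represented nega-s-adically. The $\Lambda_s$-linear functions are $y=x$; $y=1-x$, i.e. $\Delta^s_{\alpha_1\alpha_2\dots}\mapsto\Delta^s_{[s-1-\alpha_1][s-1-\alpha_2]\dots}$; and $y=-\frac{s-1}{s+1}-x$, i.e. $\Delta^{-s}_{\alpha_1\alpha_2\dots}\mapsto\Delta^{-s}_{[s-1-\alpha_1][s-1-\alpha_2]\dots}$. Convention (making functions other than the $\Lambda_s$-linear ones well defined): of the two representations of an s-adic rational argument, the one with period $(s-1)$ is not used; of the two representations of a nega-s-adic rational argument, the one with period $(0[s-1])$, i.e. $\Delta^{-s}_{\alpha_1\dots\alpha_{n-1}[\alpha_n-1]0[s-1]0[s-1]\dots}$, is not used.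
   Formalization: When argument and value use different systems, the differentiable maps x − s/(s+1) and 1/(s+1) − x (s-adic to nega-s-adic), and x + s/(s+1) and 1/(s+1) − x (nega-s-adic to s-adic), are also excluded, since affine members such as x − s/(s+1) (k = 2) refute the claim as stated. *)

theory Defs
  imports Complex_Main
begin

text \<open>
  Digit sequences are indexed from 0: \<open>a n\<close> is the digit $\alpha_{n+1}$.
\<close>

datatype repr = Sadic | Nega

fun repr_value :: "repr \<Rightarrow> nat \<Rightarrow> (nat \<Rightarrow> nat) \<Rightarrow> real" where
  "repr_value Sadic s a = (\<Sum>n. real (a n) / real s ^ Suc n)"
| "repr_value Nega s a = (\<Sum>n. (-1) ^ Suc n * real (a n) / real s ^ Suc n)"

fun repr_domain :: "repr \<Rightarrow> nat \<Rightarrow> real set" where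
  "repr_domain Sadic s = {0..1}"
| "repr_domain Nega s = {- real s / (real s + 1)..1 / (real s + 1)}"

text \<open>
  The representation that is not used for a rational argument: some digit
  $\alpha-1$ with $0 < \alpha < s$, followed by the pure period $(s-1)$, resp. $(0[s-1])$.
  The condition on the digit before the period matters. It keeps
  $\Delta^s_{[s-1][s-1]\ldots}$ and the alternating sequences, which are the only
  representations of end points, and in the nega-s-adic case it distinguishes the
  discarded tail $0[s-1]0[s-1]\ldots$ from the retained tail $[s-1]0[s-1]0\ldots$.
\<close>

fun discarded :: "repr \<Rightarrow> nat \<Rightarrow> (nat \<Rightarrow> nat) \<Rightarrow> bool" where
  "discarded Sadic s a \<longleftrightarrow> (\<exists>n. a n < s - 1 \<and> (\<forall>m>n. a m = s - 1))"
| "discarded Nega s a \<longleftrightarrow>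
     (\<exists>n. a n < s - 1 \<and> (\<forall>j. a (n + 1 + 2 * j) = 0 \<and> a (n + 2 + 2 * j) = s - 1))"

definition admissible :: "repr \<Rightarrow> nat \<Rightarrow> (nat \<Rightarrow> nat) \<Rightarrow> bool" where
  "admissible u s a \<longleftrightarrow> (\<forall>n. a n < s) \<and> \<not> discarded u s a"

definition digit_words :: "nat \<Rightarrow> nat \<Rightarrow> nat list set" where
  "digit_words s k = {w. length w = k \<and> set w \<subseteq> {..<s}}"

definition digit_block :: "nat \<Rightarrow> (nat \<Rightarrow> nat) \<Rightarrow> nat \<Rightarrow> nat list" where
  "digit_block k a m = map a [k * m..<k * (m + 1)]"

definition block_image :: "nat \<Rightarrow> (nat list \<Rightarrow> nat list) \<Rightarrow> (nat \<Rightarrow> nat) \<Rightarrow> nat \<Rightarrow> nat" where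
  "block_image k \<theta> a n = \<theta> (digit_block k a (n div k)) ! (n mod k)"

text \<open>
  \<open>Lambda_class s u v\<close>: the functions of the class $\Lambda_s$ whose argument is represented
  in the system \<open>u\<close> and whose value is represented in the system \<open>v\<close>. Only the
  values on \<open>repr_domain u s\<close> are constrained.
\<close>

definition Lambda_class :: "nat \<Rightarrow> repr \<Rightarrow> repr \<Rightarrow> (real \<Rightarrow> real) set" where
  "Lambda_class s u v =
     {f. \<exists>k \<theta>. k > 0 \<and> bij_betw \<theta> (digit_words s k) (digit_words s k) \<and>
           (\<forall>a. admissible u s a \<longrightarrow>
                f (repr_value u s a) = repr_value v s (block_image k \<theta> a))}"

definition Lambda_linear :: "nat \<Rightarrow> repr \<Rightarrow> (real \<Rightarrow> real) \<Rightarrow> bool" where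
  "Lambda_linear s u f \<longleftrightarrow>
     (\<forall>x\<in>repr_domain u s. f x = x) \<or>
     (\<forall>x\<in>repr_domain u s. f x = 1 - x) \<or>
     (\<forall>x\<in>repr_domain u s. f x = - (real s - 1) / (real s + 1) - x)"

text \<open>
  When argument and value are represented in different systems and \<open>k\<close> is even, the class
  contains further affine functions: complementing every second digit turns an
  s-adic expansion into a nega-s-adic one, up to a translation. They have to be excluded as
  well; see \<open>translation_in_Lambda_class\<close> and \<open>translation_not_Lambda_linear\<close> below.
\<close>

fun mixed_linear :: "nat \<Rightarrow> repr \<Rightarrow> repr \<Rightarrow> (real \<Rightarrow> real) \<Rightarrow> bool" where
  "mixed_linear s Sadic Nega f \<longleftrightarrow>
     (\<forall>x\<in>repr_domain Sadic s. f x = x - real s / (real s + 1)) \<or>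
     (\<forall>x\<in>repr_domain Sadic s. f x = 1 / (real s + 1) - x)"
| "mixed_linear s Nega Sadic f \<longleftrightarrow>
     (\<forall>x\<in>repr_domain Nega s. f x = x + real s / (real s + 1)) \<or>
     (\<forall>x\<in>repr_domain Nega s. f x = 1 / (real s + 1) - x)"
| "mixed_linear s Sadic Sadic f \<longleftrightarrow> False"
| "mixed_linear s Nega Nega f \<longleftrightarrow> False"

lemma block_image_2:
  assumes \<theta>: "\<theta> = (\<lambda>w. [s - 1 - w ! 0, w ! 1])"
  shows "block_image 2 \<theta> a n = (if even n then s - 1 - a n else a n)"
proof -
  have b: "digit_block 2 a m = [a (2 * m), a (2 * m + 1)]" for m
    by (simp add: digit_block_def upt_rec)
  show ?thesis
  proof (cases "even n")
    case True
    then show ?thesis by (auto simp: block_image_def b \<theta>)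
  next
    case False
    then obtain m where "n = 2 * m + 1" by (elim oddE)
    then show ?thesis by (simp add: block_image_def b \<theta>)
  qed
qed

lemma translation_in_Lambda_class:
  assumes s: "s > 1"
  shows "(\<lambda>x. x - real s / (real s + 1)) \<in> Lambda_class s Sadic Nega"
proof -
  define \<theta> :: "nat list \<Rightarrow> nat list" where "\<theta> = (\<lambda>w. [s - 1 - w ! 0, w ! 1])"
  have inv: "\<theta> (\<theta> w) = w \<and> \<theta> w \<in> digit_words s 2" if "w \<in> digit_words s 2" for w
  proof -
    from that obtain x y where "w = [x, y]" "x < s" "y < s"
      by (auto simp: digit_words_def length_Suc_conv numeral_2_eq_2)
    then show ?thesis by (auto simp: \<theta>_def digit_words_def)
  qed
  have bij: "bij_betw \<theta> (digit_words s 2) (digit_words s 2)"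
    by (rule bij_betw_byWitness[where f' = \<theta>]) (use inv in auto)
  have eq: "repr_value Sadic s a - real s / (real s + 1)
              = repr_value Nega s (block_image 2 \<theta> a)"
    if a: "\<forall>n. a n < s" for a
  proof -
    let ?r = "1 / real s"
    let ?g = "\<lambda>n. (real s - 1) / 2 * (?r * ?r ^ n + ?r * (- ?r) ^ n)"
    have r: "norm ?r < 1" "norm (- ?r) < 1" using s by auto
    have "?g sums ((real s - 1) / 2 * (?r * (1 / (1 - ?r)) + ?r * (1 / (1 - (- ?r)))))"
      by (intro sums_mult sums_add geometric_sums r)
    also have "(real s - 1) / 2 * (?r * (1 / (1 - ?r)) + ?r * (1 / (1 - (- ?r))))
                 = real s / (real s + 1)"
      using s by (simp add: divide_simps)
    finally have g: "?g sums (real s / (real s + 1))" .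
    have "summable (\<lambda>n. real (a n) / real s ^ Suc n)"
    proof (rule summable_comparison_test)
      show "\<exists>N. \<forall>n\<ge>N. norm (real (a n) / real s ^ Suc n) \<le> ?r ^ n"
      proof (intro exI allI impI)
        fix n
        have "real (a n) \<le> real s" using a[rule_format, of n] by simp
        then show "norm (real (a n) / real s ^ Suc n) \<le> ?r ^ n"
          using s by (simp add: power_one_over field_simps)
      qed
      show "summable (\<lambda>n. ?r ^ n)" by (rule summable_geometric[OF r(1)])
    qed
    then have "(\<lambda>n. real (a n) / real s ^ Suc n) sums repr_value Sadic s a"
      by (simp add: summable_sums)
    from sums_diff[OF this g]
    have "(\<lambda>n. real (a n) / real s ^ Suc n - ?g n)
            sums (repr_value Sadic s a - real s / (real s + 1))" .
    also have "(\<lambda>n. real (a n) / real s ^ Suc n - ?g n)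
        = (\<lambda>n. (-1) ^ Suc n * real (block_image 2 \<theta> a n) / real s ^ Suc n)"
    proof
      fix n
      have le: "a n \<le> s - 1" using a[rule_format, of n] by simp
      have rd: "real (s - Suc (a n)) = real s - 1 - real (a n)"
        using a[rule_format, of n] by (simp add: of_nat_diff Suc_le_eq)
      show "real (a n) / real s ^ Suc n - ?g n
              = (-1) ^ Suc n * real (block_image 2 \<theta> a n) / real s ^ Suc n"
        using s by (cases "even n")
          (auto simp: block_image_2[OF \<theta>_def] rd power_one_over field_simps)
    qed
    finally show ?thesis by (simp add: sums_iff)
  qed
  show ?thesis
    unfolding Lambda_class_def
    by (intro CollectI exI[of _ 2] exI[of _ \<theta>]) (use bij eq in \<open>auto simp: admissible_def\<close>)
qed

lemma translation_not_Lambda_linear: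
  assumes s: "s > 1"
  shows "\<not> Lambda_linear s Sadic (\<lambda>x. x - real s / (real s + 1))"
proof
  let ?f = "\<lambda>x. x - real s / (real s + 1)"
  assume *: "Lambda_linear s Sadic ?f"
  have mem: "(0::real) \<in> repr_domain Sadic s" "(1::real) \<in> repr_domain Sadic s" by auto
  from * consider "?f 0 = 0" | "?f 0 = 1 - 0"
    | "?f 0 = - (real s - 1) / (real s + 1) - 0" "?f 1 = - (real s - 1) / (real s + 1) - 1"
    unfolding Lambda_linear_def using mem by blast
  then show False using s by cases (simp_all add: field_simps)
qed

end

theory Submission
  imports Defs
begin

text \<open>
  Both systems are the series $\sum_n \alpha_n \rho^{n+1}$ for a base $\rho = \pm 1/s$, and in both
  the set of values is an interval of length 1. This lets all four combinations of systems be
  treated at once.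

  Suppose that \<open>f\<close> has derivative \<open>L\<close> at one point \<open>x\<close>. Keep the first \<open>m\<close> blocks of the digits of
  \<open>x\<close> and continue once with a word \<open>p\<close> and zeros, once with a word \<open>q\<close> and zeros. The two points so
  obtained lie within $s^{-km}$ of \<open>x\<close>, they differ by $\rho_u^{km}$ times the difference of the
  values of \<open>p\<close> and \<open>q\<close>, and their images differ by $\rho_v^{km}$ times the difference of the values
  of \<open>\<theta> p\<close> and \<open>\<theta> q\<close>. Their distance being comparable to $s^{-km}$, the difference quotient over
  the pair tends to \<open>L\<close> as \<open>m\<close> grows (\<open>derivative_straddle\<close>). It depends on \<open>m\<close> only through the
  sign $(\rho_v/\rho_u)^{km}$, so this sign is constant and \<open>\<theta>\<close> is affine with slope \<open>L\<close> on
  the values of words (\<open>block_permutation_affine\<close>). Because the continuations end in zeros, they are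
  never the discarded representations, whatever \<open>x\<close> is: rational arguments and end points
  are covered by the same argument as the others.

  Summation over the blocks turns the affine law for words into $f(t) = Lt + E$ on the whole domain
  (\<open>affine_on_domain\<close>); this uses that every point of the domain has a representation that is not
  discarded (\<open>admissible_representation_exists\<close>). A bijection between finite sets of equal diameter
  cannot contract, so $|L| \ge 1$ (\<open>slope_at_least_1\<close>), while \<open>f\<close> maps an interval of
  length 1 into an interval of length 1. Hence $L = \pm 1$, the constant \<open>E\<close> is forced by the
  end points, and the resulting maps are exactly the excluded linear ones.
\<close>

section \<open>The common form of both representations\<close>

definition base :: "repr \<Rightarrow> nat \<Rightarrow> real" where
  "base u s = (case u of Sadic \<Rightarrow> 1 / real s | Nega \<Rightarrow> - 1 / real s)"

definition left_end :: "repr \<Rightarrow> nat \<Rightarrow> real" where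
  "left_end u s = (case u of Sadic \<Rightarrow> 0 | Nega \<Rightarrow> - real s / (real s + 1))"

lemma repr_domain_unit_interval: "repr_domain u s = {left_end u s..left_end u s + 1}"
  by (cases u) (auto simp: left_end_def field_simps)

lemma repr_value_power_series:
  "repr_value u s a = (\<Sum>n. real (a n) * base u s ^ Suc n)"
proof (cases u)
  case Sadic
  then show ?thesis by (simp add: base_def power_one_over divide_inverse power_inverse)
next
  case Nega
  have "(- 1 / real s) ^ n = (- 1) ^ n / real s ^ n" for n
    by (rule power_divide)
  with Nega show ?thesis
    by (simp only: repr_value.simps base_def repr.case) (simp add: mult_ac)
qed

lemma abs_base: "\<bar>base u s\<bar> = 1 / real s"
  by (cases u) (auto simp: base_def)

lemma base_nonzero: "s > 1 \<Longrightarrow> base u s \<noteq> 0"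
  by (cases u) (auto simp: base_def)

lemma base_power_tendsto_0:
  assumes "s > 1"
  shows "(\<lambda>n. base u s ^ n) \<longlonglongrightarrow> 0"
  using assms by (intro LIMSEQ_abs_realpow_zero2) (simp add: abs_base)

lemma summable_digit_series:
  assumes "s > 1" and "\<forall>n. a n < s"
  shows "summable (\<lambda>n. real (a n) * base u s ^ Suc n)"
proof (rule summable_comparison_test)
  show "\<exists>N. \<forall>n\<ge>N. norm (real (a n) * base u s ^ Suc n) \<le> (1 / real s) ^ n"
  proof (intro exI allI impI)
    fix n
    have "real (a n) * (1 / real s) \<le> 1" using assms(2)[rule_format, of n] by simp
    then have "real (a n) * (1 / real s) * (1 / real s) ^ n \<le> 1 * (1 / real s) ^ n"
      by (intro mult_right_mono) auto
    then show "norm (real (a n) * base u s ^ Suc n) \<le> (1 / real s) ^ n"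
      by (simp add: abs_mult power_abs abs_base mult.assoc)
  qed
  show "summable (\<lambda>n. (1 / real s) ^ n)"
    using assms(1) by (intro summable_geometric) simp
qed

lemma repr_value_split:
  assumes "s > 1" and "\<forall>n. a n < s"
  shows "repr_value u s a =
    (\<Sum>n<N. real (a n) * base u s ^ Suc n) + base u s ^ N * repr_value u s (\<lambda>n. a (n + N))"
proof -
  have "repr_value u s a = (\<Sum>n. real (a (n + N)) * base u s ^ Suc (n + N))
          + (\<Sum>n<N. real (a n) * base u s ^ Suc n)"
    unfolding repr_value_power_series
    by (rule suminf_split_initial_segment[OF summable_digit_series[OF assms]])
  also have "(\<Sum>n. real (a (n + N)) * base u s ^ Suc (n + N))
      = (\<Sum>n. base u s ^ N * (real (a (n + N)) * base u s ^ Suc n))"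
    by (simp add: power_add mult_ac)
  also have "\<dots> = base u s ^ N * repr_value u s (\<lambda>n. a (n + N))"
    unfolding repr_value_power_series
    by (rule suminf_mult) (rule summable_digit_series[OF assms(1)], use assms(2) in blast)
  finally show ?thesis by simp
qed

text \<open>
  A number is determined by its sequence of remainders: unrolling the recursion \<open>N\<close> times leaves
  an error $\rho^N X_N$, which vanishes in the limit as long as the remainders stay bounded. Both the
  values of periodic sequences and the correctness of the digit algorithm below come from this.
\<close>

lemma repr_value_eqI:
  assumes s: "s > 1"
    and step: "\<And>n. X n = base u s * (real (a n) + X (Suc n))"
    and bounded: "\<And>n. \<bar>X n\<bar> \<le> C"
  shows "repr_value u s a = X 0"
proof -
  have partial: "X 0 = (\<Sum>n<N. real (a n) * base u s ^ Suc n) + base u s ^ N * X N" for N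
  proof (induction N)
    case (Suc N)
    then show ?case using step[of N] by (simp add: algebra_simps)
  qed simp
  have partial_eq: "(\<Sum>n<N. real (a n) * base u s ^ Suc n) = X 0 - base u s ^ N * X N" for N
    using partial[of N] by simp
  have "(\<lambda>N. base u s ^ N * X N) \<longlonglongrightarrow> 0"
  proof (rule tendsto_0_le[OF base_power_tendsto_0[OF s]])
    show "\<forall>\<^sub>F N in sequentially. norm (base u s ^ N * X N) \<le> norm (base u s ^ N) * C"
      by (intro always_eventually allI) (simp add: abs_mult mult_left_mono bounded)
  qed
  then have "(\<lambda>N. X 0 - base u s ^ N * X N) \<longlonglongrightarrow> X 0 - 0"
    by (intro tendsto_intros)
  then have "(\<lambda>n. real (a n) * base u s ^ Suc n) sums X 0"
    unfolding sums_def partial_eq by simp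
  then show ?thesis
    by (simp only: repr_value_power_series sums_iff)
qed

section \<open>The range of a representation\<close>

text \<open>
  The digits of the greatest and the least number that can be represented. In the nega-s-adic
  system the coefficient at index \<open>n\<close> is negative for even \<open>n\<close>, so there the sequence is
  $0[s-1]0[s-1]\ldots$, the period of a discarded representation.
\<close>

definition top_digit :: "repr \<Rightarrow> nat \<Rightarrow> nat \<Rightarrow> nat" where
  "top_digit u s n = (if u = Nega \<and> even n then 0 else s - 1)"

definition bottom_digit :: "repr \<Rightarrow> nat \<Rightarrow> nat \<Rightarrow> nat" where
  "bottom_digit u s n = s - 1 - top_digit u s n"

lemma top_digit_less: "s > 1 \<Longrightarrow> \<forall>n. top_digit u s n < s"
  by (auto simp: top_digit_def)

lemma bottom_digit_less: "s > 1 \<Longrightarrow> \<forall>n. bottom_digit u s n < s"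
  by (auto simp: bottom_digit_def)

lemma base_power_sign:
  "base u s ^ Suc n = (if u = Nega \<and> even n then - 1 else 1) * \<bar>base u s\<bar> ^ Suc n"
  by (cases u) (auto simp: base_def power_divide)

lemma digit_term_bounds:
  assumes "d < s"
  shows "real d * base u s ^ Suc n \<le> real (top_digit u s n) * base u s ^ Suc n"
    and "real (bottom_digit u s n) * base u s ^ Suc n \<le> real d * base u s ^ Suc n"
proof -
  have "real d * c \<le> real (s - 1) * c" if "c \<ge> 0" for c
    using assms that by (intro mult_right_mono) auto
  then show "real d * base u s ^ Suc n \<le> real (top_digit u s n) * base u s ^ Suc n"
    and "real (bottom_digit u s n) * base u s ^ Suc n \<le> real d * base u s ^ Suc n"
    unfolding base_power_sign bottom_digit_def top_digit_def by (auto simp del: power_Suc)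
qed

lemma repr_value_top:
  assumes s: "s > 1"
  shows "repr_value u s (top_digit u s) = left_end u s + 1"
proof -
  \<comment> \<open>A negative base exchanges the two ends of the interval at each shift of the digits.\<close>
  define X where "X n = (if u = Nega \<and> odd n then left_end u s else left_end u s + 1)" for n :: nat
  have "repr_value u s (top_digit u s) = X 0"
  proof (rule repr_value_eqI[OF s])
    show "X n = base u s * (real (top_digit u s n) + X (Suc n))" for n
      using s by (cases u) (auto simp: X_def base_def left_end_def top_digit_def of_nat_diff field_simps)
    show "\<bar>X n\<bar> \<le> \<bar>left_end u s\<bar> + 1" for n by (auto simp: X_def)
  qed
  then show ?thesis by (simp add: X_def)
qed

lemma repr_value_bottom:
  assumes s: "s > 1"
  shows "repr_value u s (bottom_digit u s) = left_end u s"
proof -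
  define X where "X n = (if u = Nega \<and> odd n then left_end u s + 1 else left_end u s)" for n :: nat
  have "repr_value u s (bottom_digit u s) = X 0"
  proof (rule repr_value_eqI[OF s])
    show "X n = base u s * (real (bottom_digit u s n) + X (Suc n))" for n
      using s by (cases u)
        (auto simp: X_def base_def left_end_def top_digit_def bottom_digit_def of_nat_diff field_simps)
    show "\<bar>X n\<bar> \<le> \<bar>left_end u s\<bar> + 1" for n by (auto simp: X_def)
  qed
  then show ?thesis by (simp add: X_def)
qed

lemma repr_value_in_domain:
  assumes "s > 1" and "\<forall>n. a n < s"
  shows "repr_value u s a \<in> repr_domain u s"
proof -
  note summ = summable_digit_series[OF assms(1)]
  have "repr_value u s a \<le> repr_value u s (top_digit u s)"
    unfolding repr_value_power_series
    using assms(2) by (intro suminf_le digit_term_bounds summ assms top_digit_less[OF assms(1)]) auto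
  moreover have "repr_value u s (bottom_digit u s) \<le> repr_value u s a"
    unfolding repr_value_power_series
    using assms(2) by (intro suminf_le digit_term_bounds summ assms bottom_digit_less[OF assms(1)]) auto
  ultimately show ?thesis
    using assms(1) by (simp add: repr_domain_unit_interval repr_value_top repr_value_bottom)
qed

section \<open>Admissible representations\<close>

text \<open>
  In either system a discarded representation is a non-maximal digit followed by the expansion of
  the right end point of the domain. This is what makes the digit algorithm avoid it.
\<close>

lemma discarded_top_tail:
  assumes "discarded u s a"
  obtains N where "a N < s - 1" and "(\<lambda>n. a (n + Suc N)) = top_digit u s"
proof (cases u)
  case Sadic
  then obtain N where N: "a N < s - 1" "\<forall>m>N. a m = s - 1" using assms by auto
  have "(\<lambda>n. a (n + Suc N)) = top_digit u s"
    using N(2) Sadic by (auto simp: top_digit_def)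
  with N(1) show ?thesis by (rule that)
next
  case Nega
  then obtain N where N: "a N < s - 1"
    "\<And>j. a (N + 1 + 2 * j) = 0" "\<And>j. a (N + 2 + 2 * j) = s - 1" using assms by auto
  have "a (n + Suc N) = top_digit u s n" for n
  proof (cases "even n")
    case True
    then obtain j where "n = 2 * j" by blast
    then show ?thesis using N(2)[of j] Nega by (simp add: top_digit_def add_ac)
  next
    case False
    then obtain j where "n = 2 * j + 1" by (elim oddE)
    then show ?thesis using N(3)[of j] Nega by (simp add: top_digit_def add_ac)
  qed
  with N(1) show ?thesis by (intro that) auto
qed

lemma admissible_eventually_0:
  assumes s: "s > 1" and digits: "\<forall>n. a n < s" and zero: "\<And>n. n \<ge> M \<Longrightarrow> a n = 0"
  shows "admissible u s a"
proof -
  have "\<not> discarded u s a"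
  proof
    assume "discarded u s a"
    then obtain N where N: "(\<lambda>n. a (n + Suc N)) = top_digit u s"
      by (rule discarded_top_tail)
    have "a (2 * M + 1 + Suc N) = top_digit u s (2 * M + 1)"
      using N by (rule fun_cong)
    then show False using zero[of "2 * M + 1 + Suc N"] s by (simp add: top_digit_def)
  qed
  then show ?thesis using digits by (simp add: admissible_def)
qed

text \<open>
  The largest digit that leaves a remainder not below the left end point. The minimum with
  \<open>s - 1\<close> matters only at an end point of the domain, where the quotient equals \<open>s\<close>.
\<close>

definition greedy_digit :: "repr \<Rightarrow> nat \<Rightarrow> real \<Rightarrow> nat" where
  "greedy_digit u s y = min (s - 1) (nat \<lfloor>y / base u s - left_end u s\<rfloor>)"

text \<open>
  The last property is the one that excludes discarded representations: the remainder reaches the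
  right end point only after the maximal digit.
\<close>

lemma greedy_digit_remainder:
  fixes y :: real
  assumes s: "s > 1" and y: "y \<in> repr_domain u s"
  defines "d \<equiv> greedy_digit u s y"
  shows "d < s" and "y / base u s - real d \<in> repr_domain u s"
    and "d < s - 1 \<Longrightarrow> y / base u s - real d < left_end u s + 1"
proof -
  define t where "t = y / base u s - left_end u s"
  have t: "0 \<le> t \<and> t \<le> real s"
  proof (cases u)
    case Sadic
    with y s show ?thesis by (simp add: t_def left_end_def base_def mult_left_le_one_le)
  next
    case Nega
    have "- real s * y \<le> - real s * (- real s / (real s + 1))"
      using y s Nega by (intro mult_left_mono_neg) auto
    moreover have "- real s * (1 / (real s + 1)) \<le> - real s * y"
      using y s Nega by (intro mult_left_mono_neg) auto
    moreover have "- real s * (- real s / (real s + 1)) + real s / (real s + 1) = real s"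
      by (simp add: field_simps add_nonneg_eq_0_iff)
    moreover have "t = - real s * y + real s / (real s + 1)"
      using Nega by (simp add: t_def left_end_def base_def)
    ultimately show ?thesis by simp
  qed
  have d: "d = min (s - 1) (nat \<lfloor>t\<rfloor>)" by (simp add: d_def greedy_digit_def t_def)
  show "d < s" using s by (simp add: d)
  have "0 \<le> t - real d \<and> t - real d \<le> 1"
    using t s unfolding d by (auto simp: min_def of_nat_diff split: if_splits) linarith+
  then show "y / base u s - real d \<in> repr_domain u s"
    by (simp add: repr_domain_unit_interval t_def)
  show "y / base u s - real d < left_end u s + 1" if "d < s - 1"
  proof -
    have "d = nat \<lfloor>t\<rfloor>" using that unfolding d by simp
    then have "t - real d < 1" using t by linarith
    then show ?thesis by (simp add: t_def)
  qed
qed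

lemma admissible_representation_exists:
  assumes s: "s > 1" and x: "x \<in> repr_domain u s"
  obtains a where "admissible u s a" and "repr_value u s a = x"
proof -
  define X where "X = rec_nat x (\<lambda>_ y. y / base u s - real (greedy_digit u s y))"
  define a where "a n = greedy_digit u s (X n)" for n
  have X_Suc: "X (Suc n) = X n / base u s - real (a n)" for n by (simp add: X_def a_def)
  have X: "X n \<in> repr_domain u s" for n
  proof (induction n)
    case 0
    then show ?case using x by (simp add: X_def)
  next
    case (Suc n)
    then show ?case unfolding X_Suc a_def by (rule greedy_digit_remainder[OF s])
  qed
  have digits: "\<forall>n. a n < s" using greedy_digit_remainder(1)[OF s X] by (simp add: a_def)
  have tail: "repr_value u s (\<lambda>n. a (n + N)) = X N" for N
  proof -
    have "repr_value u s (\<lambda>n. a (n + N)) = X (0 + N)"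
    proof (rule repr_value_eqI[OF s])
      show "X (n + N) = base u s * (real (a (n + N)) + X (Suc n + N))" for n
        using base_nonzero[OF s] by (simp add: X_Suc)
      show "\<bar>X (n + N)\<bar> \<le> \<bar>left_end u s\<bar> + 1" for n
        using X[of "n + N"] by (auto simp: repr_domain_unit_interval)
    qed
    then show ?thesis by simp
  qed
  have "\<not> discarded u s a"
  proof
    assume "discarded u s a"
    then obtain N where N: "a N < s - 1" "(\<lambda>n. a (n + Suc N)) = top_digit u s"
      by (rule discarded_top_tail)
    have "X (Suc N) = left_end u s + 1"
      using tail[of "Suc N"] repr_value_top[OF s] unfolding N(2) by simp
    moreover have "X (Suc N) < left_end u s + 1"
      using N(1) greedy_digit_remainder(3)[OF s X[of N]] by (simp add: X_Suc a_def)
    ultimately show False by simp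
  qed
  moreover have "repr_value u s a = x"
    using tail[of 0] by (simp add: X_def)
  ultimately show ?thesis using digits by (intro that) (auto simp: admissible_def)
qed

section \<open>Words and blocks\<close>

definition word_value :: "repr \<Rightarrow> nat \<Rightarrow> nat list \<Rightarrow> real" where
  "word_value u s w = (\<Sum>j<length w. real (w ! j) * base u s ^ Suc j)"

definition graft :: "(nat \<Rightarrow> nat) \<Rightarrow> nat \<Rightarrow> (nat \<Rightarrow> nat) \<Rightarrow> nat \<Rightarrow> nat" where
  "graft a N b n = (if n < N then a n else b (n - N))"

definition pad :: "nat list \<Rightarrow> nat \<Rightarrow> nat" where
  "pad w n = (if n < length w then w ! n else 0)"

lemma length_digit_word: "w \<in> digit_words s k \<Longrightarrow> length w = k"
  by (simp add: digit_words_def)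

lemma nth_digit_word: "w \<in> digit_words s k \<Longrightarrow> j < k \<Longrightarrow> w ! j < s"
  by (force simp: digit_words_def)

lemma digit_block_in_words: "\<forall>n. a n < s \<Longrightarrow> digit_block k a m \<in> digit_words s k"
  by (auto simp: digit_block_def digit_words_def)

lemma pad_less: "s > 1 \<Longrightarrow> w \<in> digit_words s k \<Longrightarrow> \<forall>n. pad w n < s"
  by (auto simp: pad_def length_digit_word nth_digit_word)

lemma digit_block_pad:
  assumes "w \<in> digit_words s k"
  shows "digit_block k (pad w) m = (if m = 0 then w else replicate k 0)"
proof -
  have "\<not> k * m + i < k" if "m > 0" for i using that by (cases m) auto
  then show ?thesis using assms
    by (auto intro!: nth_equalityI simp: digit_block_def pad_def length_digit_word)
qed

lemma digit_block_shift: "digit_block k (\<lambda>n. a (n + k * M)) m = digit_block k a (m + M)"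
  by (auto intro!: nth_equalityI simp: digit_block_def algebra_simps)

lemma block_image_shift:
  "k > 0 \<Longrightarrow> block_image k \<theta> a (n + k * M) = block_image k \<theta> (\<lambda>n. a (n + k * M)) n"
  by (simp add: block_image_def digit_block_shift add.commute)

lemma block_image_less:
  assumes "k > 0" and "bij_betw \<theta> (digit_words s k) (digit_words s k)" and "\<forall>n. a n < s"
  shows "\<forall>n. block_image k \<theta> a n < s"
  unfolding block_image_def
  using assms by (intro allI nth_digit_word[where k = k] bij_betw_apply[OF assms(2)] digit_block_in_words) auto

lemma graft_less: "\<forall>n. a n < s \<Longrightarrow> \<forall>n. b n < s \<Longrightarrow> \<forall>n. graft a N b n < s"
  by (simp add: graft_def)

lemma repr_value_graft:
  assumes "s > 1" and "\<forall>n. a n < s" and "\<forall>n. b n < s"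
  shows "repr_value u s (graft a N b) =
    (\<Sum>n<N. real (a n) * base u s ^ Suc n) + base u s ^ N * repr_value u s b"
proof -
  have "(\<lambda>n. graft a N b (n + N)) = b" by (simp add: graft_def)
  moreover have "(\<Sum>n<N. real (graft a N b n) * base u s ^ Suc n) = (\<Sum>n<N. real (a n) * base u s ^ Suc n)"
    by (simp add: graft_def)
  ultimately show ?thesis
    using repr_value_split[OF assms(1) graft_less[OF assms(2,3)], of u N N] by simp
qed

lemma block_image_graft:
  assumes k: "k > 0"
  shows "block_image k \<theta> (graft a (k * M) b) = graft (block_image k \<theta> a) (k * M) (block_image k \<theta> b)"
proof
  fix n
  show "block_image k \<theta> (graft a (k * M) b) n = graft (block_image k \<theta> a) (k * M) (block_image k \<theta> b) n"
  proof (cases "n < k * M")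
    case True
    then have "n div k < M" using k by (simp add: div_less_iff_less_mult mult.commute)
    then have "k * (n div k) + k \<le> k * M"
      by (metis Suc_leI mult_Suc_right add.commute mult_le_mono2)
    then have "digit_block k (graft a (k * M) b) (n div k) = digit_block k a (n div k)"
      by (auto intro!: nth_equalityI simp: digit_block_def graft_def)
    then show ?thesis using True by (simp add: block_image_def graft_def)
  next
    case False
    then obtain i where n: "n = i + k * M" using le_Suc_ex[of "k * M" n] by (auto simp: add.commute)
    have "(\<lambda>n. graft a (k * M) b (n + k * M)) = b" by (simp add: graft_def)
    then show ?thesis using block_image_shift[OF k, of \<theta> "graft a (k * M) b" i M]
      by (simp add: n graft_def)
  qed
qed

lemma repr_value_pad:
  assumes s: "s > 1" and w: "w \<in> digit_words s k"
  shows "repr_value u s (pad w) = word_value u s w"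
proof -
  have "repr_value u s (\<lambda>n. pad w (n + k)) = 0"
    using w by (simp add: repr_value_power_series pad_def length_digit_word)
  moreover have "(\<Sum>n<k. real (pad w n) * base u s ^ Suc n) = word_value u s w"
    using w by (simp add: word_value_def pad_def length_digit_word)
  ultimately show ?thesis
    using repr_value_split[OF s pad_less[OF s w], of u k] by simp
qed

text \<open>
  The zeros after a word need not be mapped to zeros, but their image is the same for all
  words of length \<open>k\<close>, so it cancels.
\<close>

lemma repr_value_block_image_pad_diff:
  assumes s: "s > 1" and k: "k > 0" and bij: "bij_betw \<theta> (digit_words s k) (digit_words s k)"
    and p: "p \<in> digit_words s k" and q: "q \<in> digit_words s k"
  shows "repr_value v s (block_image k \<theta> (pad p)) - repr_value v s (block_image k \<theta> (pad q))
    = word_value v s (\<theta> p) - word_value v s (\<theta> q)"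
proof -
  define rest where "rest = repr_value v s (block_image k \<theta> (\<lambda>_. 0))"
  have "repr_value v s (block_image k \<theta> (pad w)) = word_value v s (\<theta> w) + base v s ^ k * rest"
    if w: "w \<in> digit_words s k" for w
  proof -
    have "repr_value v s (block_image k \<theta> (pad w)) =
        (\<Sum>n<k. real (block_image k \<theta> (pad w) n) * base v s ^ Suc n)
        + base v s ^ k * repr_value v s (\<lambda>n. block_image k \<theta> (pad w) (n + k))"
      by (rule repr_value_split[OF s block_image_less[OF k bij pad_less[OF s w]]])
    moreover have "(\<lambda>n. block_image k \<theta> (pad w) (n + k)) = block_image k \<theta> (\<lambda>_. 0)"
      using block_image_shift[OF k, of \<theta> "pad w" _ 1] w
      by (simp add: pad_def length_digit_word)
    moreover have "(\<Sum>n<k. real (block_image k \<theta> (pad w) n) * base v s ^ Suc n) = word_value v s (\<theta> w)"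
      using length_digit_word[OF bij_betw_apply[OF bij w]]
      by (simp add: word_value_def block_image_def digit_block_pad[OF w])
    ultimately show ?thesis by (simp add: rest_def)
  qed
  with p q show ?thesis by simp
qed

lemma repr_value_sums_blocks:
  assumes s: "s > 1" and k: "k > 0" and a: "\<forall>n. a n < s"
  shows "(\<lambda>m. (base u s ^ k) ^ m * word_value u s (digit_block k a m)) sums repr_value u s a"
proof -
  have "(\<lambda>n. real (a n) * base u s ^ Suc n) sums repr_value u s a"
    unfolding repr_value_power_series by (rule summable_sums[OF summable_digit_series[OF s a]])
  from sums_group[OF this k] 
  have "(\<lambda>m. \<Sum>n=m * k..<m * k + k. real (a n) * base u s ^ Suc n) sums repr_value u s a" .
  moreover have "(\<Sum>n=m * k..<m * k + k. real (a n) * base u s ^ Suc n)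
      = (base u s ^ k) ^ m * word_value u s (digit_block k a m)" for m
  proof -
    have "(\<Sum>n=m * k..<m * k + k. real (a n) * base u s ^ Suc n)
        = (\<Sum>j<k. real (a (j + m * k)) * base u s ^ Suc (j + m * k))"
      using sum.shift_bounds_nat_ivl[of "\<lambda>n. real (a n) * base u s ^ Suc n" 0 "m * k" k]
      by (simp add: add.commute atLeast0LessThan)
    also have "\<dots> = (\<Sum>j<k. base u s ^ (k * m) * (real (a (k * m + j)) * base u s ^ Suc j))"
      by (rule sum.cong) (simp_all add: power_add mult_ac add_ac)
    finally show ?thesis
      by (simp add: word_value_def digit_block_def power_mult flip: sum_distrib_left)
  qed
  ultimately show ?thesis by simp
qed

lemma digit_block_block_image:
  assumes "k > 0" and "bij_betw \<theta> (digit_words s k) (digit_words s k)" and "\<forall>n. a n < s"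
  shows "digit_block k (block_image k \<theta> a) m = \<theta> (digit_block k a m)"
proof -
  have "length (\<theta> (digit_block k a m)) = k"
    by (intro length_digit_word[where s = s] bij_betw_apply[OF assms(2)] digit_block_in_words assms)
  then show ?thesis
    using assms(1) by (auto intro!: nth_equalityI simp: digit_block_def block_image_def)
qed

text \<open>
  The diameter of the set of word values is the same in both systems, because it only depends on
  the absolute value of the base.
\<close>

lemma word_value_diff_le:
  assumes "p \<in> digit_words s k" and "q \<in> digit_words s k"
  shows "\<bar>word_value u s p - word_value u s q\<bar> \<le> (\<Sum>j<k. real (s - 1) / real s ^ Suc j)"
proof -
  have "\<bar>word_value u s p - word_value u s q\<bar>
      = \<bar>\<Sum>j<k. (real (p ! j) - real (q ! j)) * base u s ^ Suc j\<bar>"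
    using assms by (simp add: word_value_def length_digit_word sum_subtractf left_diff_distrib)
  also have "\<dots> \<le> (\<Sum>j<k. \<bar>(real (p ! j) - real (q ! j)) * base u s ^ Suc j\<bar>)"
    by (rule sum_abs)
  also have "\<dots> \<le> (\<Sum>j<k. real (s - 1) / real s ^ Suc j)"
  proof (rule sum_mono)
    fix j assume "j \<in> {..<k}"
    then have "p ! j < s" "q ! j < s" using assms by (auto intro: nth_digit_word)
    then have "\<bar>real (p ! j) - real (q ! j)\<bar> \<le> real (s - 1)" by auto
    then have "\<bar>real (p ! j) - real (q ! j)\<bar> * (1 / real s) ^ Suc j \<le> real (s - 1) * (1 / real s) ^ Suc j"
      by (intro mult_right_mono) auto
    then show "\<bar>(real (p ! j) - real (q ! j)) * base u s ^ Suc j\<bar> \<le> real (s - 1) / real s ^ Suc j"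
      by (simp only: abs_mult power_abs abs_base) (simp add: power_one_over divide_inverse power_inverse)
  qed
  finally show ?thesis .
qed

lemma word_value_diff_attained:
  assumes s: "s > 1"
  obtains p q where "p \<in> digit_words s k" and "q \<in> digit_words s k"
    and "word_value u s p - word_value u s q = (\<Sum>j<k. real (s - 1) / real s ^ Suc j)"
proof
  let ?p = "map (top_digit u s) [0..<k]" and ?q = "map (bottom_digit u s) [0..<k]"
  show "?p \<in> digit_words s k" "?q \<in> digit_words s k"
    using s by (auto simp: digit_words_def top_digit_less bottom_digit_less)
  have "(real (top_digit u s j) - real (bottom_digit u s j)) * base u s ^ Suc j
      = real (s - 1) / real s ^ Suc j" for j
    unfolding base_power_sign abs_base top_digit_def bottom_digit_def
    by (auto simp: power_one_over divide_inverse power_inverse)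
  then show "word_value u s ?p - word_value u s ?q = (\<Sum>j<k. real (s - 1) / real s ^ Suc j)"
    by (simp add: word_value_def flip: sum_subtractf left_diff_distrib)
qed

section \<open>Consequences of differentiability at one point\<close>

text \<open>
  The difference quotient over two points near \<open>x\<close> converges to the derivative at \<open>x\<close> even if both
  points lie on the same side of \<open>x\<close>, provided that their distances from \<open>x\<close> are bounded by a scale
  to which their mutual distance is proportional: the errors of the two linear
  approximations are then negligible at that scale. The factor \<open>B\<close> may be 0, and the points may
  coincide with \<open>x\<close>.
\<close>

lemma derivative_straddle:
  fixes f :: "real \<Rightarrow> real"
  assumes f: "(f has_real_derivative L) (at x within S)"
    and in_S: "\<And>m. y m \<in> S" "\<And>m. z m \<in> S"
    and h: "h \<longlonglongrightarrow> 0" "\<And>m. h m \<noteq> 0"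
    and close: "\<And>m. \<bar>y m - x\<bar> \<le> \<bar>h m\<bar>" "\<And>m. \<bar>z m - x\<bar> \<le> \<bar>h m\<bar>"
    and gap: "\<And>m. y m - z m = h m * B"
  shows "(\<lambda>m. (f (y m) - f (z m)) / h m) \<longlonglongrightarrow> L * B"
proof -
  \<comment> \<open>The error of the slope, continuous at \<open>x\<close> by the assumption on \<open>f\<close>.\<close>
  define g where "g t = (if t = x then 0 else (f t - f x) / (t - x) - L)" for t
  have g: "f t - f x = (L + g t) * (t - x)" for t by (simp add: g_def)
  have "((\<lambda>t. (f t - f x) / (t - x) - L) \<longlongrightarrow> L - L) (at x within S)"
    using f unfolding has_field_derivative_iff by (intro tendsto_intros)
  also have "L - L = g x" by (simp add: g_def)
  finally have "((\<lambda>t. (f t - f x) / (t - x) - L) \<longlongrightarrow> g x) (at x within S)" .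
  then have "(g \<longlongrightarrow> g x) (at x within S)"
    by (rule Lim_transform_eventually) (auto simp: g_def eventually_at_filter)
  then have g_tendsto: "(g \<longlongrightarrow> g x) (inf (nhds x) (principal S))"
    by (simp add: tendsto_at_within_iff_tendsto_nhds)
  have limit: "(\<lambda>m. g (w m) * ((w m - x) / h m)) \<longlonglongrightarrow> 0"
    if w: "\<And>m. w m \<in> S" "\<And>m. \<bar>w m - x\<bar> \<le> \<bar>h m\<bar>" for w
  proof -
    have "(\<lambda>m. w m - x) \<longlonglongrightarrow> 0"
      by (rule tendsto_0_le[OF h(1), where K = 1]) (use w(2) in auto)
    then have "w \<longlonglongrightarrow> x" by (simp add: LIM_zero_iff)
    then have "filterlim w (inf (nhds x) (principal S)) sequentially"
      using w(1) by (simp add: filterlim_inf filterlim_principal)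
    then have "(\<lambda>m. g (w m)) \<longlonglongrightarrow> g x"
      by (rule filterlim_compose[OF g_tendsto])
    then have gw: "(\<lambda>m. g (w m)) \<longlonglongrightarrow> 0" by (simp add: g_def)
    show ?thesis
    proof (rule tendsto_0_le[OF gw, where K = 1], intro always_eventually allI)
      fix m
      have "\<bar>(w m - x) / h m\<bar> \<le> 1" using w(2)[of m] h(2)[of m] by (simp add: abs_divide)
      then show "norm (g (w m) * ((w m - x) / h m)) \<le> norm (g (w m)) * 1"
        unfolding mult_1_right real_norm_def abs_mult by (intro mult_left_le) auto
    qed
  qed
  have "(f (y m) - f (z m)) / h m
      = L * B + g (y m) * ((y m - x) / h m) - g (z m) * ((z m - x) / h m)" for m
  proof -
    have "f (y m) - f (z m) = L * (y m - z m) + g (y m) * (y m - x) - g (z m) * (z m - x)"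
      using g[of "y m"] g[of "z m"] by (simp add: algebra_simps)
    then have "(f (y m) - f (z m)) / h m
        = (L * (h m * B) + g (y m) * (y m - x) - g (z m) * (z m - x)) / h m"
      by (simp only: gap)
    also have "\<dots> = L * B + g (y m) * ((y m - x) / h m) - g (z m) * ((z m - x) / h m)"
      using h(2)[of m] by (simp add: field_simps)
    finally show ?thesis .
  qed
  moreover have "(\<lambda>m. L * B + g (y m) * ((y m - x) / h m) - g (z m) * ((z m - x) / h m))
      \<longlonglongrightarrow> L * B + 0 - 0"
    by (intro tendsto_intros limit in_S close)
  ultimately show ?thesis by simp
qed

text \<open>
  For fixed words the difference quotient over the points of comparison takes the form $\tau^m A$ with
  $\tau = (\rho_v/\rho_u)^k = \pm 1$, so convergence makes it constant. The sign is negative for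
  odd \<open>k\<close> and different systems; then $A = 0$ for every pair of words, which is impossible as
  \<open>\<theta>\<close> attains words of different values.
\<close>

lemma block_permutation_affine:
  assumes s: "s > 1" and k: "k > 0"
    and bij: "bij_betw \<theta> (digit_words s k) (digit_words s k)"
    and f: "\<And>a. admissible u s a \<Longrightarrow> f (repr_value u s a) = repr_value v s (block_image k \<theta> a)"
    and x: "x \<in> repr_domain u s"
    and deriv: "(f has_real_derivative L) (at x within repr_domain u s)"
  shows "base v s ^ k = base u s ^ k"
    and "\<And>p q. p \<in> digit_words s k \<Longrightarrow> q \<in> digit_words s k \<Longrightarrow>
      word_value v s (\<theta> p) - word_value v s (\<theta> q) = L * (word_value u s p - word_value u s q)"
proof -
  obtain a where a: "admissible u s a" "repr_value u s a = x"
    using admissible_representation_exists[OF s x] .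
  have digits: "\<forall>n. a n < s" using a(1) by (simp add: admissible_def)
  define \<tau> where "\<tau> = (base v s / base u s) ^ k"
  have "\<bar>\<tau>\<bar> = 1"
    using s by (simp add: \<tau>_def power_abs abs_divide abs_base)
  then have \<tau>: "\<tau> = 1 \<or> \<tau> = - 1" by linarith
  have limit: "(\<lambda>m. \<tau> ^ m * (word_value v s (\<theta> p) - word_value v s (\<theta> q)))
      \<longlonglongrightarrow> L * (word_value u s p - word_value u s q)"
    if p: "p \<in> digit_words s k" and q: "q \<in> digit_words s k" for p q
  proof -
    \<comment> \<open>The points of comparison, and the scale at which they approach \<open>x\<close>.\<close>
    define Y where "Y w m = repr_value u s (graft a (k * m) (pad w))" for w m
    define h where "h m = base u s ^ (k * m)" for m
    have Y: "Y w m \<in> repr_domain u s" "\<bar>Y w m - x\<bar> \<le> \<bar>h m\<bar>"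
      "f (Y w m) = repr_value v s (graft (block_image k \<theta> a) (k * m) (block_image k \<theta> (pad w)))"
      if w: "w \<in> digit_words s k" for w m
    proof -
      note pad = pad_less[OF s w] and grafted = graft_less[OF digits pad_less[OF s w]]
      show "Y w m \<in> repr_domain u s"
        unfolding Y_def by (rule repr_value_in_domain[OF s grafted])
      have "Y w m - x = h m * (repr_value u s (pad w) - repr_value u s (\<lambda>n. a (n + k * m)))"
        unfolding Y_def h_def a(2)[symmetric] repr_value_graft[OF s digits pad]
        using repr_value_split[OF s digits, of u "k * m"] by (simp add: right_diff_distrib)
      moreover have "\<bar>repr_value u s (pad w) - repr_value u s (\<lambda>n. a (n + k * m))\<bar> \<le> 1"
        using repr_value_in_domain[where u = u and a = "pad w", OF s pad]
          repr_value_in_domain[where u = u and a = "\<lambda>n. a (n + k * m)", OF s] digits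
        by (simp add: repr_domain_unit_interval abs_le_iff)
      ultimately show "\<bar>Y w m - x\<bar> \<le> \<bar>h m\<bar>"
        by (simp add: abs_mult mult_left_le)
      \<comment> \<open>The trailing zeros make the function formula applicable for every \<open>x\<close> and every \<open>w\<close>.\<close>
      have "admissible u s (graft a (k * m) (pad w))"
        by (rule admissible_eventually_0[where M = "k * m + k", OF s grafted])
          (use w in \<open>auto simp: graft_def pad_def length_digit_word\<close>)
      then show "f (Y w m) = repr_value v s (graft (block_image k \<theta> a) (k * m) (block_image k \<theta> (pad w)))"
        unfolding Y_def by (simp add: f block_image_graft[OF k])
    qed
    have "(\<lambda>m. (f (Y p m) - f (Y q m)) / h m) \<longlonglongrightarrow> L * (word_value u s p - word_value u s q)"
    proof (rule derivative_straddle[OF deriv])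
      show "h \<longlonglongrightarrow> 0"
        unfolding h_def using LIMSEQ_subseq_LIMSEQ[OF base_power_tendsto_0[OF s], of "\<lambda>m. k * m"] k
        by (simp add: strict_mono_def o_def)
      show "h m \<noteq> 0" for m using base_nonzero[OF s] by (simp add: h_def)
      show "Y p m - Y q m = h m * (word_value u s p - word_value u s q)" for m
        unfolding Y_def h_def repr_value_graft[OF s digits pad_less[OF s p]]
          repr_value_graft[OF s digits pad_less[OF s q]] repr_value_pad[OF s p] repr_value_pad[OF s q]
        by (simp add: algebra_simps)
    qed (use Y p q in auto)
    moreover have "(f (Y p m) - f (Y q m)) / h m
        = \<tau> ^ m * (word_value v s (\<theta> p) - word_value v s (\<theta> q))" for m
    proof -
      note im = block_image_less[OF k bij]
      have "f (Y p m) - f (Y q m) = base v s ^ (k * m) *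
          (repr_value v s (block_image k \<theta> (pad p)) - repr_value v s (block_image k \<theta> (pad q)))"
        unfolding Y(3)[OF p] Y(3)[OF q]
          repr_value_graft[OF s im[OF digits] im[OF pad_less[OF s p]]]
          repr_value_graft[OF s im[OF digits] im[OF pad_less[OF s q]]]
        by (simp add: algebra_simps)
      then show ?thesis
        unfolding repr_value_block_image_pad_diff[OF s k bij p q]
        by (simp add: \<tau>_def h_def power_divide power_mult)
    qed
    ultimately show ?thesis by simp
  qed
  have diff: "word_value v s (\<theta> p) - word_value v s (\<theta> q) = L * (word_value u s p - word_value u s q)"
    and sign: "\<tau> = - 1 \<Longrightarrow> word_value v s (\<theta> p) = word_value v s (\<theta> q)"
    if p: "p \<in> digit_words s k" and q: "q \<in> digit_words s k" for p q
  proof -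
    let ?A = "word_value v s (\<theta> p) - word_value v s (\<theta> q)"
    let ?B = "L * (word_value u s p - word_value u s q)"
    have "(\<lambda>m. \<tau> ^ (2 * m) * ?A) \<longlonglongrightarrow> ?B"
      using LIMSEQ_subseq_LIMSEQ[OF limit[OF p q], of "\<lambda>m. 2 * m"] by (simp add: strict_mono_def o_def)
    moreover have "\<tau> ^ (2 * m) = 1" for m using \<tau> by (auto simp: power_mult)
    ultimately show eq: "?A = ?B" by (simp add: LIMSEQ_const_iff)
    assume "\<tau> = - 1"
    have "(\<lambda>m. \<tau> ^ (2 * m + 1) * ?A) \<longlonglongrightarrow> ?B"
      using LIMSEQ_subseq_LIMSEQ[OF limit[OF p q], of "\<lambda>m. 2 * m + 1"] by (simp add: strict_mono_def o_def)
    moreover have "\<tau> ^ (2 * m + 1) = - 1" for m using \<open>\<tau> = - 1\<close> by (simp add: power_mult)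
    ultimately have "- ?A = ?B" by (simp add: LIMSEQ_const_iff)
    with eq have "?A = 0" by linarith
    then show "word_value v s (\<theta> p) = word_value v s (\<theta> q)" by simp
  qed
  have "\<tau> \<noteq> - 1"
  proof
    assume "\<tau> = - 1"
    obtain p q where pq: "p \<in> digit_words s k" "q \<in> digit_words s k"
      "word_value v s p - word_value v s q = (\<Sum>j<k. real (s - 1) / real s ^ Suc j)"
      using word_value_diff_attained[OF s] .
    obtain p' q' where "p' \<in> digit_words s k" "\<theta> p' = p" "q' \<in> digit_words s k" "\<theta> q' = q"
      using pq bij by (metis bij_betw_imp_surj_on imageE)
    then have "word_value v s p = word_value v s q" using sign[OF _ _ \<open>\<tau> = - 1\<close>] by blast
    moreover have "(\<Sum>j<k. real (s - 1) / real s ^ Suc j) > 0"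
      using s k by (intro sum_pos) auto
    ultimately show False using pq(3) by simp
  qed
  with \<tau> have "\<tau> = 1" by simp
  then show "base v s ^ k = base u s ^ k"
    using base_nonzero[OF s, of u] by (simp add: \<tau>_def power_divide)
  show "\<And>p q. p \<in> digit_words s k \<Longrightarrow> q \<in> digit_words s k \<Longrightarrow>
      word_value v s (\<theta> p) - word_value v s (\<theta> q) = L * (word_value u s p - word_value u s q)"
    by (rule diff)
qed

text \<open>
  A block at position \<open>m\<close> has the same weight $r^m$ in the argument and in the value, so the affine
  law for words can be summed; the constant terms form a geometric series.
\<close>

lemma affine_on_domain:
  assumes s: "s > 1" and k: "k > 0"
    and bij: "bij_betw \<theta> (digit_words s k) (digit_words s k)"
    and f: "\<And>a. admissible u s a \<Longrightarrow> f (repr_value u s a) = repr_value v s (block_image k \<theta> a)"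
    and same_base: "base v s ^ k = base u s ^ k"
    and word: "\<And>p q. p \<in> digit_words s k \<Longrightarrow> q \<in> digit_words s k \<Longrightarrow>
      word_value v s (\<theta> p) - word_value v s (\<theta> q) = L * (word_value u s p - word_value u s q)"
  shows "\<exists>E. \<forall>x\<in>repr_domain u s. f x = L * x + E"
proof -
  define r where "r = base u s ^ k"
  define zeros where "zeros = replicate k (0::nat)"
  define C where "C = word_value v s (\<theta> zeros) - L * word_value u s zeros"
  have zeros: "zeros \<in> digit_words s k" using s by (auto simp: zeros_def digit_words_def)
  have C: "word_value v s (\<theta> w) = L * word_value u s w + C" if "w \<in> digit_words s k" for w
    using word[OF that zeros] by (simp add: C_def algebra_simps)
  have r: "norm r < 1"
    using s k by (simp add: r_def power_abs abs_base power_one_over)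
  have "f x = L * x + C * (1 / (1 - r))" if x: "x \<in> repr_domain u s" for x
  proof -
    obtain a where a: "admissible u s a" "repr_value u s a = x"
      using admissible_representation_exists[OF s x] .
    have digits: "\<forall>n. a n < s" using a(1) by (simp add: admissible_def)
    have "(\<lambda>m. r ^ m * word_value v s (\<theta> (digit_block k a m))) sums f x"
      using repr_value_sums_blocks[OF s k block_image_less[OF k bij digits], of v] f[OF a(1)] a(2)
      by (simp add: digit_block_block_image[OF k bij digits] same_base r_def)
    then have "(\<lambda>m. L * (r ^ m * word_value u s (digit_block k a m)) + C * r ^ m) sums f x"
      using C[OF digit_block_in_words[OF digits]] by (simp add: algebra_simps)
    moreover have "(\<lambda>m. L * (r ^ m * word_value u s (digit_block k a m)) + C * r ^ m)
        sums (L * x + C * (1 / (1 - r)))"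
      unfolding r_def a(2)[symmetric]
      by (intro sums_add sums_mult repr_value_sums_blocks s k digits geometric_sums r[unfolded r_def])
    ultimately show ?thesis by (rule sums_unique2)
  qed
  then show ?thesis by blast
qed

text \<open>
  Two words whose values in the target system are as far apart as possible are images of words
  whose values in the source system are at most that far apart.
\<close>

lemma slope_at_least_1:
  assumes s: "s > 1" and k: "k > 0"
    and bij: "bij_betw \<theta> (digit_words s k) (digit_words s k)"
    and word: "\<And>p q. p \<in> digit_words s k \<Longrightarrow> q \<in> digit_words s k \<Longrightarrow>
      word_value v s (\<theta> p) - word_value v s (\<theta> q) = L * (word_value u s p - word_value u s q)"
  shows "\<bar>L\<bar> \<ge> 1"
proof -
  define d where "d = (\<Sum>j<k. real (s - 1) / real s ^ Suc j)"
  have "d > 0" unfolding d_def using s k by (intro sum_pos) auto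
  obtain p q where pq: "p \<in> digit_words s k" "q \<in> digit_words s k"
    "word_value v s p - word_value v s q = d"
    using word_value_diff_attained[OF s] unfolding d_def .
  obtain p' q' where p'q': "p' \<in> digit_words s k" "\<theta> p' = p" "q' \<in> digit_words s k" "\<theta> q' = q"
    using pq bij by (metis bij_betw_imp_surj_on imageE)
  have "d = \<bar>L\<bar> * \<bar>word_value u s p' - word_value u s q'\<bar>"
    using word[OF p'q'(1,3)] p'q' pq(3) \<open>d > 0\<close> by (simp flip: abs_mult)
  also have "\<dots> \<le> \<bar>L\<bar> * d"
    unfolding d_def by (intro mult_left_mono word_value_diff_le p'q') auto
  finally show ?thesis using \<open>d > 0\<close> by simp
qed

theorem theorem2:
  fixes s :: nat and u v :: repr and f :: "real \<Rightarrow> real"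
  assumes "s > 1"
    and "f \<in> Lambda_class s u v"
    and "\<not> Lambda_linear s u f"
    and "\<not> mixed_linear s u v f"
  shows "\<forall>x\<in>repr_domain u s. \<not> f differentiable (at x within repr_domain u s)"
proof (intro ballI notI)
  fix x assume x: "x \<in> repr_domain u s" and "f differentiable (at x within repr_domain u s)"
  then obtain L where deriv: "(f has_real_derivative L) (at x within repr_domain u s)"
    by (auto simp: real_differentiable_def)
  note s = assms(1)
  obtain k \<theta> where k: "k > 0" and bij: "bij_betw \<theta> (digit_words s k) (digit_words s k)"
    and f: "\<And>a. admissible u s a \<Longrightarrow> f (repr_value u s a) = repr_value v s (block_image k \<theta> a)"
    using assms(2) unfolding Lambda_class_def by blast
  note affine = block_permutation_affine[OF s k bij f x deriv]
  obtain E where E: "\<forall>t\<in>repr_domain u s. f t = L * t + E"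
    using affine_on_domain[OF s k bij f affine] by blast
  define l where "l = left_end u s"
  define l' where "l' = left_end v s"
  have range: "f t \<in> {l'..l' + 1}" if t: "t \<in> repr_domain u s" for t
  proof -
    obtain a where a: "admissible u s a" "repr_value u s a = t"
      using admissible_representation_exists[OF s t] .
    then have "f t = repr_value v s (block_image k \<theta> a)" using f by blast
    moreover have "\<dots> \<in> repr_domain v s"
      by (intro repr_value_in_domain[OF s] block_image_less[OF k bij])
        (use a in \<open>auto simp: admissible_def\<close>)
    ultimately show ?thesis by (simp add: repr_domain_unit_interval l'_def)
  qed
  have ends: "l \<in> repr_domain u s" "l + 1 \<in> repr_domain u s"
    by (simp_all add: repr_domain_unit_interval l_def)
  \<comment> \<open>Both end points are mapped into an interval of length 1, which bounds \<open>L\<close> and then fixes \<open>E\<close>.\<close>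
  have bounds: "l' \<le> L * l + E" "L * l + E \<le> l' + 1"
    "l' \<le> L * l + L + E" "L * l + L + E \<le> l' + 1"
    using range[OF ends(1)] range[OF ends(2)] E[rule_format, OF ends(1)] E[rule_format, OF ends(2)]
    by (simp_all add: algebra_simps)
  have "\<bar>L\<bar> \<ge> 1" using slope_at_least_1[OF s k bij affine(2)] .
  then consider "L \<ge> 1" | "L \<le> - 1" by linarith
  then have "L = 1 \<and> E = l' - l \<or> L = - 1 \<and> E = l' + 1 + l"
  proof cases
    case 1
    then have "L = 1" using bounds by linarith
    with bounds show ?thesis by simp
  next
    case 2
    then have "L = - 1" using bounds by linarith
    with bounds show ?thesis by simp
  qed
  then have "(\<forall>t\<in>repr_domain u s. f t = t + (l' - l)) \<or>
      (\<forall>t\<in>repr_domain u s. f t = l' + l + 1 - t)"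
    using E by auto
  then have "Lambda_linear s u f \<or> mixed_linear s u v f"
  proof
    assume "\<forall>t\<in>repr_domain u s. f t = t + (l' - l)"
    then show ?thesis
      by (cases u; cases v) (simp_all add: l_def l'_def left_end_def Lambda_linear_def)
  next
    assume *: "\<forall>t\<in>repr_domain u s. f t = l' + l + 1 - t"
    show ?thesis
    proof (cases "u = v")
      case True
      have "1 - 2 * (real s / (real s + 1)) = - (real s - 1) / (real s + 1)"
        by (simp add: field_simps)
      then have "l' + l + 1 = 1 \<or> l' + l + 1 = - (real s - 1) / (real s + 1)"
        using True by (cases u) (simp_all add: l_def l'_def left_end_def)
      with * show ?thesis by (auto simp: Lambda_linear_def)
    next
      case False
      then have "l' + l + 1 = 1 / (real s + 1)"
        by (cases u; cases v) (auto simp: l_def l'_def left_end_def field_simps)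
      with * False show ?thesis by (cases u; cases v) simp_all
    qed
  qed
  with assms(3,4) show False by blast
qed

end
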